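(* Let $r\ge1$ and let $a_0,\dots,a_r$ be finitely supported sequences on $\mathbb{Z}$ whose Fourier series satisfy $$\sum_{j=0}^r|\widehat a_j(\xi)|^2=1\qquad\text{for all }\xi\in\mathbb{R}.$$ Let $G=\{E,V,w\}$ be a connected weighted graph with $|V|=K$, and let $L\ge 1$ be an integer. Then the $L$-level discrete tight wavelet frame decomposition $\boldsymbol{W}$ and reconstruction $\boldsymbol{W}^\top$ on $G$ associated with the masks $a_0,\dots,a_r$ (defined in the context) satisfy $$\boldsymbol{W}^\top\boldsymbol{W}f_G=f_G\qquad\text{for all } f_G:V\to\mathbb{R}.$$
   Context: For a finitely supported sequence $a$ on $\mathbb{Z}$, $\widehat a(\xi)=\sum_{k\in\mathbb{Z}}a[k]e^{-ik\xi}$ is its Fourier series (a trigonometric polynomial); $*$ denotes complex conjugation. Graph: $V=\{v_1,\dots,v_K\}$ is a finite set of points (a discretization of a manifold $\mathcal{M}$), $E\subset V\times V$ is the (undirected) edge set, and $w:E\to\mathbb{R}^+$ is the weight function $w(v_k,v_{k'})=e^{-\|v_k-v_{k'}\|_2^2/\sigma}$ with $\sigma>0$. The adjacency matrix $A=(a_{k,k'})$ has $a_{k,k'}=w(v_k,v_{k'})$ if $v_k,v_{k'}$ are connected by an edge and $0$ otherwise; $D=\mathrm{diag}\{d[1],\dots,d[K]\}$ with $d[k]=\sum_{k'}a_{k,k'}$. The graph Laplacian $\mathcal{L}$ is one of $D-A$, $I-D^{-1}A$, $I-D^{-1/2}AD^{-1/2}$. The pairs $\{(\lambda_k,u_k)\}_{k=0}^{K-1}$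 are the eigenvalues and (real) eigenfunctions of $\mathcal{L}$, with $0=\lambda_0<\lambda_1\le\cdots\le\lambda_{K-1}$, and it is a standing assumption that the eigenfunctions form an orthonormal basis of functions on $V$: $\langle u_k,u_{k'}\rangle=\sum_{n=1}^Ku_k[n]u_{k'}[n]=\delta_{k,k'}$. The Fourier transform of a function $h$ on $V$ is $\widehat h[k]=\sum_{n=1}^K h[n]u_k[n]$, $0\le k\le K-1$; a function on $V$ is determined by its Fourier transform. Let $N$ be the smallest integer such that $\lambda_{K-1}\le 2^N\pi$. Decomposition: let $\mathbb{B}=\{(j,l):1\le j\le r,\ 1\le l\le L\}\cup\{(0,L)\}$. Define $\boldsymbol{W}f_G=\{W_{j,l}f_G:(j,l)\in\mathbb{B}\}$, where $W_{j,l}f_G$ is the (possibly complex-valued) function on $V$ with $$\widehat{W_{j,l}f_G}[k]=\begin{cases}\widehat a_j^*(2^{-N}\lambda_k)\,\widehat{f_G}[k], & l=1,\\ \widehat a_j^*(2^{-N+l-1}\lambda_k)\,\widehat a_0^*(2^{-N+l-2}\lambda_k)\cdots\widehat a_0^*(2^{-N}\lambda_k)\,\widehat{f_G}[k], & 2\le l\le L.\end{cases}$$ Reconstruction: for a family $\boldsymbol{\alpha}=\{\alpha_{j,l}:(j,l)\in\mathbb{B}\}$ of functions on $V$, define $\alpha_{0,l-1}$ successively for $l=L,L-1,\dots,1$ by $$\widehat\alpha_{0,l-1}[k]=\sum_{j=0}^r\widehat a_j(2^{-N+l-1}\lambda_k)\,\widehat\alpha_{j,l}[k],$$ and set $\boldsymbol{W}^\top\boldsymbol{\alpha}:=\alpha_{0,0}$.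 *)

theory Defs
  imports "HOL-Analysis.Analysis"
begin

definition fourier_series :: "(int \<Rightarrow> complex) \<Rightarrow> real \<Rightarrow> complex" where
  "fourier_series a \<xi> = (\<Sum>k\<in>{k. a k \<noteq> 0}. a k * exp (- \<i> * of_int k * of_real \<xi>))"

text \<open>The vertices are enumerated by a map \<open>v\<close> from a finite type \<open>'n\<close>, so that
  \<open>K = CARD('n)\<close>; functions on the vertex set are vectors indexed by \<open>'n\<close>, and matrices
  are those of HOL-Analysis. An undirected edge set is a symmetric relation.\<close>

definition edge_weight :: "real \<Rightarrow> 'p::euclidean_space \<Rightarrow> 'p \<Rightarrow> real" where
  "edge_weight \<sigma> x y = exp (- (norm (x - y))\<^sup>2 / \<sigma>)"

definition connected_graph :: "'p set \<Rightarrow> ('p \<times> 'p) set \<Rightarrow> bool" where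
  "connected_graph V E \<longleftrightarrow> (\<forall>x\<in>V. \<forall>y\<in>V. (x, y) \<in> E\<^sup>*)"

definition adjacency_matrix ::
  "('n \<Rightarrow> 'p::euclidean_space) \<Rightarrow> ('p \<times> 'p) set \<Rightarrow> real \<Rightarrow> real^'n^('n::finite)" where
  "adjacency_matrix v E \<sigma> =
     (\<chi> i j. if (v i, v j) \<in> E then edge_weight \<sigma> (v i) (v j) else 0)"

definition degree_of :: "real^'n^('n::finite) \<Rightarrow> 'n \<Rightarrow> real" where
  "degree_of A i = (\<Sum>j\<in>UNIV. A $ i $ j)"

definition diag_matrix :: "('n \<Rightarrow> real) \<Rightarrow> real^'n^('n::finite)" where
  "diag_matrix d = (\<chi> i j. if i = j then d i else 0)"

text \<open>The three Laplacians \<open>D - A\<close>, \<open>I - D\<^sup>-\<^sup>1 A\<close> and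
  \<open>I - D\<^sup>-\<^sup>1\<^sup>/\<^sup>2 A D\<^sup>-\<^sup>1\<^sup>/\<^sup>2\<close>. All degrees are positive for a connected graph
  with at least two vertices.\<close>

definition graph_laplacians :: "real^'n^('n::finite) \<Rightarrow> (real^'n^'n) set" where
  "graph_laplacians A =
     {diag_matrix (degree_of A) - A,
      mat 1 - diag_matrix (\<lambda>i. 1 / degree_of A i) ** A,
      mat 1 - diag_matrix (\<lambda>i. 1 / sqrt (degree_of A i)) ** A
                ** diag_matrix (\<lambda>i. 1 / sqrt (degree_of A i))}"

definition eigen_system ::
  "real^'n^('n::finite) \<Rightarrow> (nat \<Rightarrow> real) \<Rightarrow> (nat \<Rightarrow> real^'n) \<Rightarrow> bool" where
  "eigen_system Lap lam u \<longleftrightarrow>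
     (\<forall>k<CARD('n). Lap *v u k = lam k *\<^sub>R u k) \<and>
     (\<forall>k<CARD('n). \<forall>k'<CARD('n). u k \<bullet> u k' = (if k = k' then 1 else 0)) \<and>
     lam 0 = 0 \<and>
     (1 < CARD('n) \<longrightarrow> 0 < lam 1) \<and>
     (\<forall>k. 1 \<le> k \<and> k + 1 < CARD('n) \<longrightarrow> lam k \<le> lam (k + 1))"

definition graph_fourier :: "(nat \<Rightarrow> real^'n) \<Rightarrow> complex^('n::finite) \<Rightarrow> nat \<Rightarrow> complex" where
  "graph_fourier u h k = (\<Sum>n\<in>UNIV. h $ n * of_real (u k $ n))"

text \<open>The function on the vertex set with a prescribed Fourier transform; existence and
  uniqueness, for an orthonormal system \<open>u\<close>, are shown below.\<close>

definition with_fourier :: "(nat \<Rightarrow> real^'n) \<Rightarrow> (nat \<Rightarrow> complex) \<Rightarrow> complex^('n::finite)" where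
  "with_fourier u g = (THE h. \<forall>k<CARD('n). graph_fourier u h k = g k)"

lemma graph_fourier_ex1:
  fixes u :: "nat \<Rightarrow> real^'n::finite"
  assumes orth: "\<forall>k<CARD('n). \<forall>k'<CARD('n). u k \<bullet> u k' = (if k = k' then 1 else 0)"
  shows "\<exists>!h::complex^'n. \<forall>k<CARD('n). graph_fourier u h k = g k"
proof -
  obtain b :: "'n \<Rightarrow> nat" where b: "bij_betw b UNIV {..<CARD('n)}"
    using finite_same_card_bij[of "UNIV::'n set" "{..<CARD('n)}"] by auto
  define U :: "complex^'n^'n" where "U = (\<chi> i n. of_real (u (b i) $ n))"
  have bl: "b i < CARD('n)" for i using b by (auto simp: bij_betw_def)
  have binj: "b i = b j \<longleftrightarrow> i = j" for i j using b by (auto simp: bij_betw_def inj_def)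
  have 1: "U ** transpose U = mat 1"
  proof -
    have "(\<Sum>n\<in>UNIV. u (b i) $ n * u (b j) $ n) = (if i = j then 1 else 0)" for i j
      using orth bl[of i] bl[of j] binj[of i j] by (simp add: inner_vec_def)
    then have "(\<Sum>n\<in>UNIV. (of_real (u (b i) $ n) * of_real (u (b j) $ n) :: complex))
        = (if i = j then 1 else 0)" for i j
      by (simp flip: of_real_mult of_real_sum)
    then show ?thesis
      by (simp add: U_def vec_eq_iff matrix_matrix_mult_def transpose_def mat_def)
  qed
  then have 2: "transpose U ** U = mat 1"
    by (simp add: matrix_left_right_inverse)
  have U: "graph_fourier u h (b i) = (U *v h) $ i" for h i
    by (simp add: graph_fourier_def U_def matrix_vector_mult_def mult.commute)
  have "(\<forall>k<CARD('n). graph_fourier u h k = g k) \<longleftrightarrow> U *v h = (\<chi> i. g (b i))" for h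
  proof -
    have "(\<forall>k<CARD('n). graph_fourier u h k = g k) \<longleftrightarrow>
          (\<forall>k\<in>b ` UNIV. graph_fourier u h k = g k)"
      using b by (simp add: bij_betw_def Ball_def)
    then show ?thesis by (simp add: U vec_eq_iff)
  qed
  moreover have "\<exists>!h. U *v h = c" for c
    by (metis 1 2 matrix_vector_mul_assoc matrix_vector_mul_lid)
  ultimately show ?thesis by simp
qed

lemma graph_fourier_with_fourier:
  fixes u :: "nat \<Rightarrow> real^'n::finite"
  assumes "\<forall>k<CARD('n). \<forall>k'<CARD('n). u k \<bullet> u k' = (if k = k' then 1 else 0)"
    and "k < CARD('n)"
  shows "graph_fourier u (with_fourier u g) k = g k"
  using theI'[OF graph_fourier_ex1[OF assms(1), of g]] assms(2)
  by (simp add: with_fourier_def)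

text \<open>The smallest integer \<open>N\<close> with \<open>\<mu> \<le> 2\<^sup>N \<pi>\<close>, which may be negative. It exists exactly
  when \<open>\<mu> > 0\<close>; for a one-vertex graph it is an unspecified integer.\<close>

definition dilation_exponent :: "real \<Rightarrow> int" where
  "dilation_exponent \<mu> = (LEAST N. \<mu> \<le> 2 powi N * pi)"

lemma dilation_exponent_iff:
  assumes "\<mu> > 0"
  shows "\<mu> \<le> 2 powi N * pi \<longleftrightarrow> dilation_exponent \<mu> \<le> N"
proof -
  have eq: "\<mu> \<le> 2 powi M * pi \<longleftrightarrow> \<lceil>log 2 (\<mu> / pi)\<rceil> \<le> M" for M :: int
  proof -
    have "\<mu> \<le> 2 powi M * pi \<longleftrightarrow> \<mu> / pi \<le> 2 powr of_int M"
      by (simp add: powr_real_of_int' field_simps)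
    also have "\<dots> \<longleftrightarrow> log 2 (\<mu> / pi) \<le> of_int M"
      using assms by (simp add: log_le_iff)
    finally show ?thesis by (simp add: ceiling_le_iff)
  qed
  have "dilation_exponent \<mu> = \<lceil>log 2 (\<mu> / pi)\<rceil>"
    unfolding dilation_exponent_def eq by (rule Least_equality) auto
  with eq show ?thesis by simp
qed

definition band_index :: "nat \<Rightarrow> nat \<Rightarrow> (nat \<times> nat) set" where
  "band_index r L = {(j, l). 1 \<le> j \<and> j \<le> r \<and> 1 \<le> l \<and> l \<le> L} \<union> {(0, L)}"

text \<open>In both operators \<open>N\<close>, \<open>lam\<close> and \<open>u\<close> are the dilation exponent and the eigenpairs.
  For \<open>l = 1\<close> the product of low-pass factors is empty.\<close>

definition wavelet_decomposition ::
  "(nat \<Rightarrow> int \<Rightarrow> complex) \<Rightarrow> nat \<Rightarrow> nat \<Rightarrow> int \<Rightarrow> (nat \<Rightarrow> real) \<Rightarrow> (nat \<Rightarrow> real^'n)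
    \<Rightarrow> complex^('n::finite) \<Rightarrow> nat \<times> nat \<Rightarrow> complex^'n" where
  "wavelet_decomposition a r L N lam u f =
     restrict (\<lambda>(j, l). with_fourier u (\<lambda>k.
         cnj (fourier_series (a j) (2 powi (- N + int l - 1) * lam k))
         * (\<Prod>m=2..l. cnj (fourier_series (a 0) (2 powi (- N + int m - 2) * lam k)))
         * graph_fourier u f k))
       (band_index r L)"

text \<open>\<open>low_pass a r L N lam u \<alpha> i\<close> is the function \<open>\<alpha>\<^bsub>0,L-i\<^esub>\<close> of the reconstruction; the
  step from \<open>i\<close> to \<open>Suc i\<close> is the one with level \<open>l = L - i\<close>.\<close>

primrec low_pass ::
  "(nat \<Rightarrow> int \<Rightarrow> complex) \<Rightarrow> nat \<Rightarrow> nat \<Rightarrow> int \<Rightarrow> (nat \<Rightarrow> real) \<Rightarrow> (nat \<Rightarrow> real^'n)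
    \<Rightarrow> (nat \<times> nat \<Rightarrow> complex^('n::finite)) \<Rightarrow> nat \<Rightarrow> complex^'n" where
  "low_pass a r L N lam u \<alpha> 0 = \<alpha> (0, L)"
| "low_pass a r L N lam u \<alpha> (Suc i) =
     with_fourier u (\<lambda>k. \<Sum>j=0..r.
       fourier_series (a j) (2 powi (- N + int (L - i) - 1) * lam k)
       * graph_fourier u (if j = 0 then low_pass a r L N lam u \<alpha> i else \<alpha> (j, L - i)) k)"

definition wavelet_reconstruction ::
  "(nat \<Rightarrow> int \<Rightarrow> complex) \<Rightarrow> nat \<Rightarrow> nat \<Rightarrow> int \<Rightarrow> (nat \<Rightarrow> real) \<Rightarrow> (nat \<Rightarrow> real^'n)
    \<Rightarrow> (nat \<times> nat \<Rightarrow> complex^('n::finite)) \<Rightarrow> complex^'n" where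
  "wavelet_reconstruction a r L N lam u \<alpha> = low_pass a r L N lam u \<alpha> L"

end

theory Submission imports Defs begin

text \<open>Everything is diagonal in the orthonormal eigenbasis. Up to level \<open>l\<close> the decomposition
  multiplies the \<open>k\<close>-th coefficient by a product of \<open>l\<close> conjugated low-pass factors; one
  reconstruction step, from level \<open>l\<close> to \<open>l - 1\<close>, replaces the outermost of these factors by
  the sum of the \<open>|a\<^sub>j|\<^sup>2\<close> at the dilated frequency, which is \<open>1\<close>. After \<open>L\<close> steps no
  factor is left.\<close>

lemma graph_fourier_inject:
  fixes u :: "nat \<Rightarrow> real^'n::finite" and h h' :: "complex^'n"
  assumes "\<forall>k<CARD('n). \<forall>k'<CARD('n). u k \<bullet> u k' = (if k = k' then 1 else 0)"
    and "\<And>k. k < CARD('n) \<Longrightarrow> graph_fourier u h k = graph_fourier u h' k"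
  shows "h = h'"
  using graph_fourier_ex1[OF assms(1), of "graph_fourier u h'"] assms(2) by blast

text \<open>Membership in \<open>band_index r L\<close> is essential here: elsewhere
  \<open>restrict\<close> makes the decomposition \<open>undefined\<close>.\<close>

lemma graph_fourier_wavelet_decomposition:
  fixes u :: "nat \<Rightarrow> real^'n::finite"
  assumes "\<forall>k<CARD('n). \<forall>k'<CARD('n). u k \<bullet> u k' = (if k = k' then 1 else 0)"
    and "k < CARD('n)" and "(j, l) \<in> band_index r L"
  shows "graph_fourier u (wavelet_decomposition a r L N lam u f (j, l)) k =
    cnj (fourier_series (a j) (2 powi (- N + int l - 1) * lam k))
    * (\<Prod>m=2..l. cnj (fourier_series (a 0) (2 powi (- N + int m - 2) * lam k)))
    * graph_fourier u f k"
  using assms by (simp add: wavelet_decomposition_def graph_fourier_with_fourier)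

text \<open>The induction invariant. The factor with index \<open>m\<close> carries the dilation of
  level \<open>m - 1\<close>, so the range from 2 to \<open>Suc (L - i)\<close> holds one low-pass
  factor for each of the levels 1 to \<open>L - i\<close>.\<close>

lemma graph_fourier_low_pass_decomposition:
  fixes u :: "nat \<Rightarrow> real^'n::finite"
  assumes tight: "\<forall>\<xi>. (\<Sum>j=0..r. (cmod (fourier_series (a j) \<xi>))\<^sup>2) = 1"
    and orth: "\<forall>k<CARD('n). \<forall>k'<CARD('n). u k \<bullet> u k' = (if k = k' then 1 else 0)"
    and k: "k < CARD('n)" and "L \<ge> 1" and "i \<le> L"
  shows "graph_fourier u (low_pass a r L N lam u (wavelet_decomposition a r L N lam u f) i) k =
    (\<Prod>m=2..Suc (L - i). cnj (fourier_series (a 0) (2 powi (- N + int m - 2) * lam k)))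
    * graph_fourier u f k"
  using \<open>i \<le> L\<close>
proof (induction i)
  case 0
  \<comment> \<open>With \<open>L\<close> a successor, the top factor \<open>m = Suc L\<close>
    splits off the product; it is the leading factor of the band \<open>(0, L)\<close>.\<close>
  obtain l where L: "L = Suc l" using \<open>L \<ge> 1\<close> by (cases L) auto
  have "(0, L) \<in> band_index r L" by (simp add: band_index_def)
  from graph_fourier_wavelet_decomposition[OF orth k this] show ?case
    by (simp add: L mult_ac add.commute)
next
  case (Suc i)
  define l where "l = L - Suc i"
  have l: "L - i = Suc l" using Suc.prems by (simp add: l_def)
  define A where "A j = fourier_series (a j) (2 powi (- N + int (Suc l) - 1) * lam k)" for j
  define P where
    "P = (\<Prod>m=2..Suc l. cnj (fourier_series (a 0) (2 powi (- N + int m - 2) * lam k)))"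
  let ?W = "wavelet_decomposition a r L N lam u f"
  \<comment> \<open>All inputs of the step at level \<open>Suc l\<close> share the factor
    \<open>P\<close>; only the conjugated mask in front depends on \<open>j\<close>. For
    \<open>j = 0\<close> this mask is the last factor of the induction hypothesis.\<close>
  have band: "graph_fourier u
      (if j = 0 then low_pass a r L N lam u ?W i else ?W (j, Suc l)) k
      = cnj (A j) * P * graph_fourier u f k" if "j \<le> r" for j
  proof (cases "j = 0")
    case True
    have "graph_fourier u (low_pass a r L N lam u ?W i) k =
        (\<Prod>m=2..Suc (Suc l). cnj (fourier_series (a 0) (2 powi (- N + int m - 2) * lam k)))
        * graph_fourier u f k"
      using Suc.IH Suc.prems unfolding l by simp
    then show ?thesis
      using True by (simp add: A_def P_def mult_ac)
  next
    case False
    then have "(j, Suc l) \<in> band_index r L"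
      using that Suc.prems by (auto simp: band_index_def l_def)
    from graph_fourier_wavelet_decomposition[OF orth k this] False show ?thesis
      by (simp add: A_def P_def)
  qed
  \<comment> \<open>All masks of one level are evaluated at the same frequency, so tightness applies
    there.\<close>
  have "(\<Sum>j=0..r. A j * cnj (A j)) = of_real (\<Sum>j=0..r. (cmod (A j))\<^sup>2)"
    unfolding of_real_sum by (intro sum.cong refl complex_norm_square[symmetric])
  also have "\<dots> = 1"
    using tight by (simp add: A_def)
  finally have one: "(\<Sum>j=0..r. A j * cnj (A j)) = 1" .
  have "graph_fourier u (low_pass a r L N lam u ?W (Suc i)) k =
      (\<Sum>j=0..r. A j * graph_fourier u
        (if j = 0 then low_pass a r L N lam u ?W i else ?W (j, Suc l)) k)"
    unfolding low_pass.simps l A_def using orth k by (simp only: graph_fourier_with_fourier)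
  also have "\<dots> = (\<Sum>j=0..r. A j * cnj (A j) * (P * graph_fourier u f k))"
    by (rule sum.cong) (simp_all add: band)
  also have "\<dots> = P * graph_fourier u f k"
    by (simp add: one flip: sum_distrib_right)
  finally show ?case
    by (simp add: P_def l_def)
qed

theorem wavelet_reconstruction_decomposition:
  fixes u :: "nat \<Rightarrow> real^'n::finite" and f :: "complex^'n"
  assumes "\<forall>\<xi>. (\<Sum>j=0..r. (cmod (fourier_series (a j) \<xi>))\<^sup>2) = 1"
    and "\<forall>k<CARD('n). \<forall>k'<CARD('n). u k \<bullet> u k' = (if k = k' then 1 else 0)"
    and "L \<ge> 1"
  shows "wavelet_reconstruction a r L N lam u (wavelet_decomposition a r L N lam u f) = f"
  unfolding wavelet_reconstruction_def
  by (rule graph_fourier_inject[OF assms(2)])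
    \<comment> \<open>At \<open>i = L\<close> the product runs from 2 to 1 and is empty.\<close>
    (simp add: graph_fourier_low_pass_decomposition[OF assms(1,2) _ assms(3) order_refl])

theorem theorem3p1:
  fixes a :: "nat \<Rightarrow> int \<Rightarrow> complex" and r L :: nat
    and V :: "'p::euclidean_space set" and v :: "'n::finite \<Rightarrow> 'p"
    and E :: "('p \<times> 'p) set" and \<sigma> :: real
    and Lap :: "real^'n^'n" and lam :: "nat \<Rightarrow> real" and u :: "nat \<Rightarrow> real^'n"
    and N :: int
  assumes "r \<ge> 1" and "L \<ge> 1"
    and "\<forall>j\<le>r. finite {k. a j k \<noteq> 0}"
    and "\<forall>\<xi>. (\<Sum>j=0..r. (cmod (fourier_series (a j) \<xi>))\<^sup>2) = 1"
    and "bij_betw v UNIV V"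
    and "E \<subseteq> V \<times> V" and "sym E" and "connected_graph V E"
    and "\<sigma> > 0"
    and "Lap \<in> graph_laplacians (adjacency_matrix v E \<sigma>)"
    and "eigen_system Lap lam u"
    and "N = dilation_exponent (lam (CARD('n) - 1))"
  shows "\<forall>f :: real^'n.
    wavelet_reconstruction a r L N lam u
      (wavelet_decomposition a r L N lam u (\<chi> n. complex_of_real (f $ n)))
    = (\<chi> n. complex_of_real (f $ n))"
  \<comment> \<open>A real signal is treated as a complex one; orthonormality is the second conjunct
    of \<open>eigen_system\<close>.\<close>
  using assms(2,4,11)
  by (intro allI wavelet_reconstruction_decomposition) (auto simp: eigen_system_def)

end
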